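(* For all integers $k_1,k_2\ge 0$, the number $\sum_{\mu} g_{k_1+\frac12}(\mu)\, g_{k_2}(\mu)$ (sum over all integer partitions $\mu$) is the number of set partitions of $[k_1+k_2+1]$ such that $k_1+1$ is the maximal element of the block containing it.
   Context: $[k]=\{1,2,\dots,k\}$. Integer partitions are identified with their Young diagrams and ordered by containment; $\emptyset$ is the only partition of $0$. A simplified vacillating tableau of shape $\mu$ and length $2k$ (respectively $2k+1$) is a sequence of integer partitions $(\mu^{(0)}=\emptyset,\mu^{(1/2)},\mu^{(1)},\mu^{(3/2)},\dots)$ ending at $\mu^{(k)}=\mu$ (respectively at $\mu^{(k+1/2)}=\mu$) such that for every integer $j\ge0$ for which the partitions involved occur in the sequence: (a) $\mu^{(j)}\supseteq\mu^{(j+1/2)}$ and $|\mu^{(j)}/\mu^{(j+1/2)}|\in\{0,1\}$; (b) $\mu^{(j+1/2)}\subseteq\mu^{(j+1)}$ and $|\mu^{(j+1)}/\mu^{(j+1/2)}|\in\{0,1\}$. $g_k(\mu)$ and $g_{k+\frac12}(\mu)$ are the numbers of simplified vacillating tableaux of shape $\mu$ of lengths $2k$ and $2k+1$, respectively. *)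

theory Defs
  imports "HOL-Analysis.Infinite_Sum" "HOL-Library.Disjoint_Sets"
begin

text \<open>A partition is the weakly decreasing list of its (positive) parts; the empty list is the
  partition of 0.\<close>

definition int_partition :: "nat list \<Rightarrow> bool" where
  "int_partition \<mu> \<longleftrightarrow> sorted_wrt (\<ge>) \<mu> \<and> 0 \<notin> set \<mu>"

definition young_diagram :: "nat list \<Rightarrow> (nat \<times> nat) set" where
  "young_diagram \<mu> = {(i, j). i < length \<mu> \<and> j < \<mu> ! i}"

definition contained :: "nat list \<Rightarrow> nat list \<Rightarrow> bool" where
  "contained \<nu> \<mu> \<longleftrightarrow> young_diagram \<nu> \<subseteq> young_diagram \<mu>"

definition skew_size :: "nat list \<Rightarrow> nat list \<Rightarrow> nat" where
  "skew_size \<mu> \<nu> = card (young_diagram \<mu> - young_diagram \<nu>)"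

text \<open>A tableau of length \<open>n\<close> is a list of \<open>n + 1\<close> partitions whose \<open>i\<close>-th entry is
  \<open>\<mu>\<close> with superscript \<open>i / 2\<close>; thus \<open>n\<close> is \<open>2 * k\<close> or \<open>2 * k + 1\<close>.\<close>

definition simplified_vacillating_tableau :: "nat \<Rightarrow> nat list \<Rightarrow> nat list list \<Rightarrow> bool" where
  "simplified_vacillating_tableau n \<mu> T \<longleftrightarrow>
     length T = n + 1 \<and> (\<forall>\<nu> \<in> set T. int_partition \<nu>) \<and> T ! 0 = [] \<and> T ! n = \<mu> \<and>
     (\<forall>j. 2 * j + 1 \<le> n \<longrightarrow>
        contained (T ! (2 * j + 1)) (T ! (2 * j)) \<and>
        skew_size (T ! (2 * j)) (T ! (2 * j + 1)) \<in> {0, 1}) \<and>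
     (\<forall>j. 2 * j + 2 \<le> n \<longrightarrow>
        contained (T ! (2 * j + 1)) (T ! (2 * j + 2)) \<and>
        skew_size (T ! (2 * j + 2)) (T ! (2 * j + 1)) \<in> {0, 1})"

definition g :: "nat \<Rightarrow> nat list \<Rightarrow> nat" where
  "g k \<mu> = card {T. simplified_vacillating_tableau (2 * k) \<mu> T}"

text \<open>The value with index \<open>k + 1/2\<close>.\<close>

definition g_half :: "nat \<Rightarrow> nat list \<Rightarrow> nat" where
  "g_half k \<mu> = card {T. simplified_vacillating_tableau (2 * k + 1) \<mu> T}"

end

theory Submission
  imports Defs
begin

text \<open>
  Write \<open>D v \<mu>\<close> for the sum of \<open>v\<close> over the partitions that are \<open>\<mu>\<close> or \<open>\<mu>\<close> plus one box
  (\<open>upper \<mu>\<close>), and \<open>U v \<mu>\<close> for the sum of \<open>v\<close> over those that are \<open>\<mu>\<close> or \<open>\<mu>\<close> minus one box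
  (\<open>lower \<mu>\<close>). Splitting off the last step of a tableau gives
  \<open>g_half k = D (g k)\<close> and \<open>g (Suc k) = U (g_half k)\<close>, where \<open>g 0\<close> is the indicator of the
  empty partition. Thus \<open>g k = (U D)\<^sup>k (g 0)\<close> and \<open>g_half k = D (U D)\<^sup>k (g 0)\<close>. Young's lattice
  supplies two facts about these operators.

  They satisfy \<open>D U = U D + 1\<close> (\<open>sum_neighbours_commute\<close>), because Young's lattice is a
  differential poset: two distinct partitions have equally many common upper and common lower
  neighbours, and a partition has one more addable than removable box. Consequently
  \<open>D (U D) = (U D + 1) D\<close>, and as \<open>D\<close> fixes \<open>g 0\<close>,
  \<open>g_half k = (U D + 1)\<^sup>k (g 0)\<close>, which is the binomial sum of the \<open>g i\<close> with \<open>i \<le> k\<close>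
  (\<open>g_half_eq_binomial_sum\<close>).

  They are adjoint to each other (\<open>sum_times_sum_lower\<close>), so \<open>U D\<close> is self-adjoint and
  \<open>\<Sum>\<mu>. g i \<mu> * g j \<mu> = g (i + j) []\<close> (\<open>sum_g_mult_g\<close>).

  Together, \<open>\<Sum>\<mu>. g_half k1 \<mu> * g k2 \<mu> = \<Sum>i\<le>k1. (k1 choose i) * g (i + k2) []\<close>. Since \<open>U\<close>
  does not change the value at the empty partition, the case \<open>k2 = 0\<close> of this identity reads
  \<open>g (Suc n) [] = \<Sum>i\<le>n. (n choose i) * g i []\<close>. This is the recursion of the Bell numbers,
  so \<open>g n []\<close> counts the set partitions of an \<open>n\<close>-element set (\<open>card_partition_on_eq_g\<close>).
  The right-hand side of the combined identity now counts the required set partitions according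
  to the number \<open>i\<close> of elements below \<open>k1 + 1\<close> that are outside its block: once the block is removed,
  these and the \<open>k2\<close> elements above \<open>k1 + 1\<close> are partitioned arbitrarily.
\<close>

section \<open>Partitions as order ideals\<close>

definition order_ideal :: "(nat \<times> nat) set \<Rightarrow> bool" where
  "order_ideal D \<longleftrightarrow>
     finite D \<and> (\<forall>i j i' j'. (i, j) \<in> D \<longrightarrow> i' \<le> i \<longrightarrow> j' \<le> j \<longrightarrow> (i', j') \<in> D)"

definition row :: "nat list \<Rightarrow> nat \<Rightarrow> nat" where
  "row \<mu> i = (if i < length \<mu> then \<mu> ! i else 0)"

lemma mem_young_diagram_iff: "(i, j) \<in> young_diagram \<mu> \<longleftrightarrow> j < row \<mu> i"
  by (auto simp: young_diagram_def row_def)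

lemma row_antimono:
  assumes "int_partition \<mu>" "i \<le> i'"
  shows "row \<mu> i' \<le> row \<mu> i"
proof (cases "i = i'")
  case False
  then show ?thesis
    using assms by (auto simp: row_def int_partition_def sorted_wrt_iff_nth_less)
qed auto

lemma finite_young_diagram: "finite (young_diagram \<mu>)"
proof -
  have "young_diagram \<mu> = (SIGMA i:{..<length \<mu>}. {..<\<mu> ! i})"
    by (auto simp: young_diagram_def)
  then show ?thesis by auto
qed

lemma order_ideal_young_diagram:
  assumes "int_partition \<mu>"
  shows "order_ideal (young_diagram \<mu>)"
  unfolding order_ideal_def mem_young_diagram_iff
proof (intro conjI allI impI)
  fix i j i' j' assume "j < row \<mu> i" "i' \<le> i" "j' \<le> j"
  then show "j' < row \<mu> i'"
    using row_antimono[OF assms, of i' i] by linarith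
qed (rule finite_young_diagram)

lemma young_diagram_inj:
  assumes "int_partition \<mu>" "int_partition \<nu>" "young_diagram \<mu> = young_diagram \<nu>"
  shows "\<mu> = \<nu>"
proof -
  have row: "row \<mu> i = row \<nu> i" for i
    using assms(3) mem_young_diagram_iff[of i _ \<mu>] mem_young_diagram_iff[of i _ \<nu>]
    by (metis linorder_neqE_nat less_irrefl)
  have len: "i < length \<xi> \<longleftrightarrow> row \<xi> i > 0" if "int_partition \<xi>" for \<xi> i
    using that by (auto simp: row_def int_partition_def in_set_conv_nth)
  have "i < length \<mu> \<longleftrightarrow> i < length \<nu>" for i
    using len assms row by metis
  then have "length \<mu> = length \<nu>"
    by (metis linorder_neqE_nat less_irrefl)
  moreover have "\<mu> ! i = \<nu> ! i" if "i < length \<mu>" for i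
    using row[of i] that calculation by (simp add: row_def)
  ultimately show ?thesis by (rule nth_equalityI)
qed

lemma downset_nat_eq_lessThan_card:
  fixes J :: "nat set"
  assumes "finite J" and down: "\<And>j j'. j \<in> J \<Longrightarrow> j' \<le> j \<Longrightarrow> j' \<in> J"
  shows "J = {..<card J}"
proof (cases "J = {}")
  case False
  have "J = {..Max J}"
  proof (intro equalityI subsetI)
    fix j assume "j \<in> {..Max J}"
    then show "j \<in> J"
      using down[OF Max_in[OF assms(1) False]] by simp
  qed (simp add: assms(1))
  then have "card J = Suc (Max J)"
    by (metis card_atMost)
  with \<open>J = {..Max J}\<close> show ?thesis
    by (simp add: lessThan_Suc_atMost)
qed simp

text \<open>Together with \<open>young_diagram_inj\<close>, this lets lattice operations and the addition or
  removal of boxes be carried out on sets of boxes and then read as operations on partitions.\<close>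

lemma order_ideal_imp_young_diagram:
  assumes D: "order_ideal D"
  obtains \<mu> where "int_partition \<mu>" "young_diagram \<mu> = D"
proof -
  define I where "I = {i. (i, 0) \<in> D}"
  define J where "J i = {j. (i, j) \<in> D}" for i
  have down: "(i', j') \<in> D" if "(i, j) \<in> D" "i' \<le> i" "j' \<le> j" for i j i' j'
    using D that unfolding order_ideal_def by blast
  have fin: "finite D" using D by (simp add: order_ideal_def)
  have finJ: "finite (J i)" for i
    by (rule finite_subset[of _ "snd ` D"]) (use fin in \<open>force simp: J_def\<close>)+
  have finI: "finite I"
    by (rule finite_subset[of _ "fst ` D"]) (use fin in \<open>force simp: I_def\<close>)+
  have J: "J i = {..<card (J i)}" for i
    by (rule downset_nat_eq_lessThan_card[OF finJ]) (auto simp: J_def intro: down)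
  have I: "I = {..<card I}"
    by (rule downset_nat_eq_lessThan_card[OF finI]) (auto simp: I_def intro: down)
  define \<mu> where "\<mu> = map (\<lambda>i. card (J i)) [0..<card I]"
  have mem: "(i, j) \<in> D \<longleftrightarrow> j < card (J i)" for i j
    using J[of i] unfolding J_def by auto
  have memI: "(i, 0) \<in> D \<longleftrightarrow> i < card I" for i
    using I unfolding I_def by auto
  have "int_partition \<mu>"
    unfolding int_partition_def
  proof
    have "card (J i') \<le> card (J i)" if "i \<le> i'" for i i'
      by (rule card_mono[OF finJ]) (use that in \<open>auto simp: J_def intro: down\<close>)
    then show "sorted_wrt (\<ge>) \<mu>"
      by (auto simp: \<mu>_def sorted_wrt_iff_nth_less)
    show "0 \<notin> set \<mu>"
      using mem[of _ 0] memI by (auto simp: \<mu>_def)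
  qed
  moreover have "young_diagram \<mu> = D"
  proof (rule set_eqI, clarify)
    fix i j
    have "(i, j) \<in> D \<Longrightarrow> i < card I"
      using down[of i j i 0] memI by auto
    then show "(i, j) \<in> young_diagram \<mu> \<longleftrightarrow> (i, j) \<in> D"
      using mem[of i j] by (auto simp: young_diagram_def \<mu>_def)
  qed
  ultimately show ?thesis using that by blast
qed

section \<open>Neighbours in Young's lattice\<close>

definition upper :: "nat list \<Rightarrow> nat list set" where
  "upper \<mu> = {\<nu>. int_partition \<nu> \<and> contained \<mu> \<nu> \<and> skew_size \<nu> \<mu> \<in> {0, 1}}"

definition lower :: "nat list \<Rightarrow> nat list set" where
  "lower \<mu> = {\<nu>. int_partition \<nu> \<and> contained \<nu> \<mu> \<and> skew_size \<mu> \<nu> \<in> {0, 1}}"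

abbreviation psize :: "nat list \<Rightarrow> nat" where
  "psize \<mu> \<equiv> card (young_diagram \<mu>)"

lemma skew_size_le_1_iff:
  assumes "contained \<nu> \<mu>"
  shows "skew_size \<mu> \<nu> \<in> {0, 1} \<longleftrightarrow> psize \<mu> \<le> psize \<nu> + 1"
proof -
  have "skew_size \<mu> \<nu> = psize \<mu> - psize \<nu>"
    using assms by (simp add: skew_size_def contained_def card_Diff_subset finite_young_diagram)
  then show ?thesis by auto
qed

text \<open>Comparing sizes instead of counting boxes of a skew shape makes both neighbour relations
  accessible to the modular law for cardinalities.\<close>

lemma mem_upper_iff:
  "\<nu> \<in> upper \<mu> \<longleftrightarrow>
     int_partition \<nu> \<and> young_diagram \<mu> \<subseteq> young_diagram \<nu> \<and> psize \<nu> \<le> psize \<mu> + 1"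
  using skew_size_le_1_iff[of \<mu> \<nu>] unfolding upper_def contained_def by blast

lemma mem_lower_iff:
  "\<nu> \<in> lower \<mu> \<longleftrightarrow>
     int_partition \<nu> \<and> young_diagram \<nu> \<subseteq> young_diagram \<mu> \<and> psize \<mu> \<le> psize \<nu> + 1"
  using skew_size_le_1_iff[of \<nu> \<mu>] unfolding lower_def contained_def by blast

lemma mem_lower_iff_mem_upper:
  assumes "int_partition \<mu>" "int_partition \<nu>"
  shows "\<nu> \<in> lower \<mu> \<longleftrightarrow> \<mu> \<in> upper \<nu>"
  using assms by (auto simp: mem_upper_iff mem_lower_iff)

definition partitions_upto :: "nat \<Rightarrow> nat list set" where
  "partitions_upto N = {\<mu>. int_partition \<mu> \<and> psize \<mu> \<le> N}"

text \<open>A diagram with at most \<open>N\<close> boxes fits into the \<open>N\<close> by \<open>N\<close> square, because with a box it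
  contains everything above it in the same column and to its left in the same row.\<close>

lemma finite_partitions_upto: "finite (partitions_upto N)"
proof -
  have "young_diagram \<mu> \<subseteq> {..<N} \<times> {..<N}" if "\<mu> \<in> partitions_upto N" for \<mu>
  proof clarify
    fix i j assume "(i, j) \<in> young_diagram \<mu>"
    moreover have "order_ideal (young_diagram \<mu>)" and N: "psize \<mu> \<le> N"
      using that by (auto simp: partitions_upto_def order_ideal_young_diagram)
    ultimately have "(\<lambda>i. (i, 0)) ` {..i} \<subseteq> young_diagram \<mu>"
      and "(\<lambda>j. (0, j)) ` {..j} \<subseteq> young_diagram \<mu>"
      unfolding order_ideal_def by blast+
    from this[THEN card_mono[OF finite_young_diagram]] N
    show "i \<in> {..<N} \<and> j \<in> {..<N}"
      by (auto simp: card_image inj_on_def)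
  qed
  then have "young_diagram ` partitions_upto N \<subseteq> Pow ({..<N} \<times> {..<N})"
    by blast
  then have "finite (young_diagram ` partitions_upto N)"
    by (rule finite_subset) simp
  moreover have "inj_on young_diagram (partitions_upto N)"
    by (auto simp: inj_on_def partitions_upto_def young_diagram_inj)
  ultimately show ?thesis by (rule finite_imageD)
qed

lemma upper_subset: "upper \<mu> \<subseteq> partitions_upto (psize \<mu> + 1)"
  by (auto simp: mem_upper_iff partitions_upto_def)

lemma lower_subset: "lower \<mu> \<subseteq> partitions_upto (psize \<mu>)"
  by (auto simp: mem_lower_iff partitions_upto_def card_mono finite_young_diagram)

lemma finite_upper: "finite (upper \<mu>)" and finite_lower: "finite (lower \<mu>)"
  by (rule finite_subset[OF upper_subset finite_partitions_upto],
      rule finite_subset[OF lower_subset finite_partitions_upto])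

text \<open>A common upper neighbour of two distinct partitions contains their union, which is larger than
  one of them and so leaves no room for a further box: the union is the only candidate. Dually, the
  intersection is the only candidate for a common lower neighbour. As the sizes of union and
  intersection add up to the sizes of the two partitions, one candidate qualifies exactly when the
  other does.\<close>

lemma card_common_neighbours_distinct:
  assumes \<kappa>: "int_partition \<kappa>" and \<mu>: "int_partition \<mu>" and "\<kappa> \<noteq> \<mu>"
  shows "card (upper \<kappa> \<inter> upper \<mu>) = card (lower \<kappa> \<inter> lower \<mu>)"
proof -
  let ?D = "young_diagram \<kappa>" and ?E = "young_diagram \<mu>"
  note [simp] = finite_young_diagram
  have neq: "?D \<noteq> ?E"
    using assms young_diagram_inj by blast
  have ideals: "order_ideal ?D" "order_ideal ?E"
    using \<kappa> \<mu> by (auto intro: order_ideal_young_diagram)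
  then have join: "order_ideal (?D \<union> ?E)" and meet: "order_ideal (?D \<inter> ?E)"
    unfolding order_ideal_def by blast+
  obtain \<alpha> where \<alpha>: "int_partition \<alpha>" "young_diagram \<alpha> = ?D \<union> ?E"
    using join by (rule order_ideal_imp_young_diagram)
  obtain \<beta> where \<beta>: "int_partition \<beta>" "young_diagram \<beta> = ?D \<inter> ?E"
    using meet by (rule order_ideal_imp_young_diagram)
  have modular: "psize \<alpha> + psize \<beta> = psize \<kappa> + psize \<mu>"
    unfolding \<alpha> \<beta> by (rule card_Un_Int[symmetric]) simp_all
  have big: "psize \<alpha> > psize \<kappa> \<or> psize \<alpha> > psize \<mu>"
  proof -
    have "?D \<subset> ?D \<union> ?E \<or> ?E \<subset> ?D \<union> ?E" using neq by blast
    then show ?thesis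
      unfolding \<alpha> using psubset_card_mono[of "?D \<union> ?E" ?D] psubset_card_mono[of "?D \<union> ?E" ?E]
      by (elim disjE) simp_all
  qed
  have small: "psize \<beta> < psize \<kappa> \<or> psize \<beta> < psize \<mu>"
  proof -
    have "?D \<inter> ?E \<subset> ?D \<or> ?D \<inter> ?E \<subset> ?E" using neq by blast
    then show ?thesis
      unfolding \<beta> using psubset_card_mono[of ?D "?D \<inter> ?E"] psubset_card_mono[of ?E "?D \<inter> ?E"]
      by (elim disjE) simp_all
  qed
  have up: "\<nu> \<in> upper \<kappa> \<inter> upper \<mu> \<longleftrightarrow> \<nu> = \<alpha> \<and> psize \<alpha> \<le> min (psize \<kappa>) (psize \<mu>) + 1" for \<nu>
  proof
    assume a: "\<nu> \<in> upper \<kappa> \<inter> upper \<mu>"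
    then have sub: "young_diagram \<alpha> \<subseteq> young_diagram \<nu>"
      and sz: "psize \<nu> \<le> min (psize \<kappa>) (psize \<mu>) + 1" and "int_partition \<nu>"
      by (auto simp: mem_upper_iff \<alpha>)
    have "psize \<alpha> \<le> psize \<nu>" using sub by (simp add: card_mono)
    moreover have "psize \<kappa> \<le> psize \<alpha>" "psize \<mu> \<le> psize \<alpha>"
      unfolding \<alpha> by (auto intro!: card_mono)
    ultimately have "psize \<alpha> = psize \<nu>" 
      using sz big by (auto simp: min_def split: if_splits)
    then have "young_diagram \<alpha> = young_diagram \<nu>"
      using sub by (simp add: card_subset_eq)
    then show "\<nu> = \<alpha> \<and> psize \<alpha> \<le> min (psize \<kappa>) (psize \<mu>) + 1"
      using young_diagram_inj \<alpha>(1) \<open>int_partition \<nu>\<close> sz by metis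
  qed (auto simp: mem_upper_iff \<alpha>)
  have low: "\<nu> \<in> lower \<kappa> \<inter> lower \<mu> \<longleftrightarrow> \<nu> = \<beta> \<and> max (psize \<kappa>) (psize \<mu>) \<le> psize \<beta> + 1" for \<nu>
  proof
    assume a: "\<nu> \<in> lower \<kappa> \<inter> lower \<mu>"
    then have sub: "young_diagram \<nu> \<subseteq> young_diagram \<beta>"
      and sz: "max (psize \<kappa>) (psize \<mu>) \<le> psize \<nu> + 1" and "int_partition \<nu>"
      by (auto simp: mem_lower_iff \<beta>)
    have "psize \<nu> \<le> psize \<beta>" using sub by (simp add: card_mono)
    moreover have "psize \<beta> \<le> psize \<kappa>" "psize \<beta> \<le> psize \<mu>"
      unfolding \<beta> by (auto intro!: card_mono)
    ultimately have "psize \<nu> = psize \<beta>"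
      using sz small by (auto simp: max_def split: if_splits)
    then have "young_diagram \<nu> = young_diagram \<beta>"
      using sub by (simp add: card_subset_eq)
    then show "\<nu> = \<beta> \<and> max (psize \<kappa>) (psize \<mu>) \<le> psize \<beta> + 1"
      using young_diagram_inj \<beta>(1) \<open>int_partition \<nu>\<close> sz by metis
  qed (auto simp: mem_lower_iff \<beta>)
  have "psize \<alpha> \<le> min (psize \<kappa>) (psize \<mu>) + 1 \<longleftrightarrow> max (psize \<kappa>) (psize \<mu>) \<le> psize \<beta> + 1"
    using modular by (auto simp: min_def max_def)
  moreover have "upper \<kappa> \<inter> upper \<mu> =
      (if psize \<alpha> \<le> min (psize \<kappa>) (psize \<mu>) + 1 then {\<alpha>} else {})"
    using up by (intro set_eqI) auto
  moreover have "lower \<kappa> \<inter> lower \<mu> =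
      (if max (psize \<kappa>) (psize \<mu>) \<le> psize \<beta> + 1 then {\<beta>} else {})"
    using low by (intro set_eqI) auto
  ultimately show ?thesis by simp
qed

text \<open>A box can be removed from row \<open>i\<close> iff row \<open>i + 1\<close> is strictly shorter, and that is when a box
  can be added to row \<open>i + 1\<close>. Row \<open>0\<close> always admits a further box, which accounts for the
  difference of one.\<close>

lemma card_upper:
  assumes \<mu>: "int_partition \<mu>"
  shows "card (upper \<mu>) = card (lower \<mu>) + 1"
proof -
  let ?D = "young_diagram \<mu>"
  define R where "R = {i. row \<mu> (Suc i) < row \<mu> i}"
  define A where "A = insert 0 (Suc ` R)"
  define add where "add i = insert (i, row \<mu> i) ?D" for i
  define rem where "rem i = ?D - {(i, row \<mu> i - 1)}" for i
  note [simp] = finite_young_diagram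
  have ideal: "order_ideal ?D" using \<mu> by (rule order_ideal_young_diagram)
  then have down: "(i', j') \<in> ?D" if "(i, j) \<in> ?D" "i' \<le> i" "j' \<le> j" for i j i' j'
    using that unfolding order_ideal_def by blast
  have inj: "inj_on young_diagram X" if "X \<subseteq> Collect int_partition" for X
    using that young_diagram_inj by (auto simp: inj_on_def subset_iff)
  have "R \<subseteq> {..<length \<mu>}"
    by (auto simp: R_def row_def split: if_splits)
  then have finR: "finite R" by (rule finite_subset) simp
  then have cardA: "card A = card R + 1"
    unfolding A_def by (subst card_insert_disjoint) (auto simp: card_image)
  (* The partition itself is its own neighbour on either side. *)
  have up: "young_diagram ` upper \<mu> = insert ?D (add ` A)"
  proof (intro equalityI subsetI)
    fix E assume "E \<in> young_diagram ` upper \<mu>"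
    then obtain \<nu> where \<nu>: "int_partition \<nu>" "?D \<subseteq> E" "card E \<le> card ?D + 1"
      "E = young_diagram \<nu>"
      by (auto simp: mem_upper_iff)
    then have fE: "finite E" and iE: "order_ideal E" by (auto intro: order_ideal_young_diagram)
    show "E \<in> insert ?D (add ` A)"
    proof (cases "E = ?D")
      case False
      then have "card ?D < card E"
        using \<nu>(2) fE by (intro psubset_card_mono) auto
      then have "card (E - ?D) = 1"
        using \<nu>(2,3) card_Diff_subset[of ?D E] by simp
      then obtain x where "E - ?D = {x}" by (auto simp: card_1_singleton_iff)
      then obtain i j where E: "E = insert (i, j) ?D" and ij: "(i, j) \<notin> ?D"
        using \<nu>(2) by (cases x) blast
      have dE: "(i', j') \<in> E" if "i' \<le> i" "j' \<le> j" for i' j'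
        using iE E that unfolding order_ideal_def by blast
      have "j = row \<mu> i"
      proof (rule ccontr)
        assume "j \<noteq> row \<mu> i"
        then have "row \<mu> i < j" using ij by (auto simp: mem_young_diagram_iff)
        then show False using dE[of i "row \<mu> i"] by (auto simp: E mem_young_diagram_iff)
      qed
      moreover have "i \<in> A"
      proof (cases i)
        case (Suc i0)
        have "row \<mu> i < row \<mu> i0"
          using dE[of i0 j] Suc \<open>j = row \<mu> i\<close> by (auto simp: E mem_young_diagram_iff)
        then show ?thesis by (auto simp: A_def R_def Suc)
      qed (simp add: A_def)
      ultimately show ?thesis by (auto simp: add_def E)
    qed simp
  next
    fix E assume "E \<in> insert ?D (add ` A)"
    moreover have "?D \<in> young_diagram ` upper \<mu>"
      using \<mu> by (auto simp: mem_upper_iff)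
    moreover have "add i \<in> young_diagram ` upper \<mu>" if i: "i \<in> A" for i
    proof -
      have "order_ideal (add i)"
        unfolding order_ideal_def
      proof (intro conjI allI impI)
        fix a b a' b' assume ab: "(a, b) \<in> add i" "a' \<le> a" "b' \<le> b"
        show "(a', b') \<in> add i"
        proof (cases "(a, b) \<in> ?D")
          case True
          then show ?thesis using down ab by (auto simp: add_def)
        next
          case False
          then have [simp]: "a = i" "b = row \<mu> i" using ab by (auto simp: add_def)
          consider "a' = i" | i0 where "i = Suc i0" "a' \<le> i0" "i0 \<in> R"
            using ab i by (cases "a' = i") (auto simp: A_def)
          then show ?thesis
          proof cases
            case 1
            then show ?thesis using ab by (auto simp: add_def mem_young_diagram_iff)
          next
            case 2
            then have "row \<mu> i < row \<mu> a'"
              using row_antimono[OF \<mu>, of a' i0] by (auto simp: R_def)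
            then show ?thesis using ab by (auto simp: add_def mem_young_diagram_iff)
          qed
        qed
      qed (simp add: add_def)
      then obtain \<nu> where "int_partition \<nu>" "young_diagram \<nu> = add i"
        by (rule order_ideal_imp_young_diagram)
      moreover have "card (add i) \<le> card ?D + 1"
        by (simp add: add_def card_insert_if)
      ultimately show ?thesis
        by (intro image_eqI[of _ _ \<nu>]) (simp_all add: mem_upper_iff, auto simp: add_def)
    qed
    ultimately show "E \<in> young_diagram ` upper \<mu>" by blast
  qed
  have low: "young_diagram ` lower \<mu> = insert ?D (rem ` R)"
  proof (intro equalityI subsetI)
    fix E assume "E \<in> young_diagram ` lower \<mu>"
    then obtain \<nu> where \<nu>: "int_partition \<nu>" "E \<subseteq> ?D" "card ?D \<le> card E + 1"
      "E = young_diagram \<nu>"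
      by (auto simp: mem_lower_iff)
    then have fE: "finite E" and iE: "order_ideal E" by (auto intro: order_ideal_young_diagram)
    show "E \<in> insert ?D (rem ` R)"
    proof (cases "E = ?D")
      case False
      then have "card E < card ?D"
        using \<nu>(2) by (intro psubset_card_mono) auto
      then have "card (?D - E) = 1"
        using \<nu>(2,3) fE card_Diff_subset[of E ?D] by simp
      then obtain x where "?D - E = {x}" by (auto simp: card_1_singleton_iff)
      then obtain i j where E: "E = ?D - {(i, j)}" and ij: "(i, j) \<in> ?D"
        using \<nu>(2) by (cases x) blast
      have dE: "(i', j') \<notin> ?D" if "i \<le> i'" "j \<le> j'" "(i', j') \<noteq> (i, j)" for i' j'
        using iE E that unfolding order_ideal_def by blast
      have "row \<mu> i \<le> j + 1" "row \<mu> (Suc i) \<le> j" "j < row \<mu> i"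
        using dE[of i "Suc j"] dE[of "Suc i" j] ij by (auto simp: mem_young_diagram_iff)
      then have "i \<in> R" "j = row \<mu> i - 1"
        by (auto simp: R_def)
      then show ?thesis by (auto simp: rem_def E)
    qed simp
  next
    fix E assume "E \<in> insert ?D (rem ` R)"
    moreover have "?D \<in> young_diagram ` lower \<mu>"
      using \<mu> by (auto simp: mem_lower_iff)
    moreover have "rem i \<in> young_diagram ` lower \<mu>" if i: "i \<in> R" for i
    proof -
      have "order_ideal (rem i)"
        unfolding order_ideal_def
      proof (intro conjI allI impI)
        fix a b a' b' assume ab: "(a, b) \<in> rem i" "a' \<le> a" "b' \<le> b"
        show "(a', b') \<in> rem i"
        proof (cases "(a', b') = (i, row \<mu> i - 1)")
          case True
          have "b < row \<mu> a" "(a, b) \<noteq> (i, row \<mu> i - 1)"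
            using ab by (auto simp: rem_def mem_young_diagram_iff)
          moreover have "row \<mu> a \<le> row \<mu> (Suc i)" if "a \<noteq> i"
            using row_antimono[OF \<mu>, of "Suc i" a] that ab True by auto
          ultimately show ?thesis using True ab i by (cases "a = i") (auto simp: R_def)
        next
          case False
          then show ?thesis using ab down by (auto simp: rem_def)
        qed
      qed (simp add: rem_def)
      then obtain \<nu> where "int_partition \<nu>" "young_diagram \<nu> = rem i"
        by (rule order_ideal_imp_young_diagram)
      moreover have "card ?D \<le> card (rem i) + 1"
        by (simp add: rem_def card_Diff_singleton_if) arith
      ultimately show ?thesis
        by (intro image_eqI[of _ _ \<nu>]) (simp_all add: mem_lower_iff, simp add: rem_def)
    qed
    ultimately show "E \<in> young_diagram ` lower \<mu>" by blast
  qed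
  have "card (upper \<mu>) = card (insert ?D (add ` A))"
    unfolding up[symmetric] by (rule card_image[symmetric], rule inj) (auto simp: mem_upper_iff)
  also have "\<dots> = card A + 1"
  proof -
    have new: "(i, row \<mu> i) \<notin> ?D" for i by (simp add: mem_young_diagram_iff)
    have "?D \<notin> add ` A" using new by (auto simp: add_def)
    moreover have "inj_on add A"
      using new by (intro inj_onI) (auto simp: add_def)
    moreover have "finite A" using finR by (simp add: A_def)
    ultimately show ?thesis by (simp add: card_image)
  qed
  finally have "card (upper \<mu>) = card A + 1" .
  moreover have "card (lower \<mu>) = card (insert ?D (rem ` R))"
    unfolding low[symmetric] by (rule card_image[symmetric], rule inj) (auto simp: mem_lower_iff)
  moreover have "card (insert ?D (rem ` R)) = card R + 1"
  proof -
    have old: "(i, row \<mu> i - 1) \<in> ?D" if "i \<in> R" for i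
      using that by (auto simp: mem_young_diagram_iff R_def)
    have "?D \<notin> rem ` R" using old by (auto simp: rem_def)
    moreover have "inj_on rem R"
      using old by (intro inj_onI) (auto simp: rem_def)
    ultimately show ?thesis using finR by (simp add: card_image)
  qed
  ultimately show ?thesis using cardA by simp
qed

lemma card_common_neighbours:
  assumes "int_partition \<kappa>" "int_partition \<mu>"
  shows "card (upper \<kappa> \<inter> upper \<mu>) = card (lower \<kappa> \<inter> lower \<mu>) + (if \<kappa> = \<mu> then 1 else 0)"
  using assms by (cases "\<kappa> = \<mu>") (simp_all add: card_common_neighbours_distinct card_upper)


section \<open>The two neighbour sums as operators\<close>

text \<open>The relation \<open>D U = U D + 1\<close>. In either iterated sum the coefficient of \<open>v \<kappa>\<close> is the number of
  common neighbours of \<open>\<mu>\<close> and \<open>\<kappa>\<close>. The summation is over a finite set \<open>S\<close> that contains every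
  partition reachable from \<open>\<mu>\<close> in two steps, so that the sums may be exchanged.\<close>

lemma sum_neighbours_commute:
  fixes v :: "nat list \<Rightarrow> nat"
  assumes \<mu>: "int_partition \<mu>"
  shows "(\<Sum>\<nu>\<in>upper \<mu>. \<Sum>\<kappa>\<in>lower \<nu>. v \<kappa>) = (\<Sum>\<nu>\<in>lower \<mu>. \<Sum>\<kappa>\<in>upper \<nu>. v \<kappa>) + v \<mu>"
proof -
  define S where "S = partitions_upto (psize \<mu> + 1)"
  have S: "finite S" "\<And>\<kappa>. \<kappa> \<in> S \<Longrightarrow> int_partition \<kappa>"
    by (simp_all add: S_def finite_partitions_upto) (simp add: partitions_upto_def)
  have "\<mu> \<in> S"
    using \<mu> by (simp add: S_def partitions_upto_def)
  have up: "lower \<nu> = {\<kappa>. \<kappa> \<in> S \<and> \<nu> \<in> upper \<kappa>}" if "\<nu> \<in> upper \<mu>" for \<nu>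
  proof -
    have "lower \<nu> \<subseteq> S"
      using that lower_subset[of \<nu>] by (fastforce simp: S_def mem_upper_iff partitions_upto_def)
    moreover have "int_partition \<nu>"
      using that by (simp add: mem_upper_iff)
    ultimately show ?thesis
      using S(2) by (auto simp: mem_lower_iff_mem_upper)
  qed
  have low: "upper \<nu> = {\<kappa>. \<kappa> \<in> S \<and> \<nu> \<in> lower \<kappa>}" if "\<nu> \<in> lower \<mu>" for \<nu>
  proof -
    have "psize \<nu> \<le> psize \<mu>"
      using that lower_subset[of \<mu>] by (auto simp: partitions_upto_def)
    then have "upper \<nu> \<subseteq> S"
      using upper_subset[of \<nu>] by (fastforce simp: S_def partitions_upto_def)
    moreover have "int_partition \<nu>"
      using that by (simp add: mem_lower_iff)
    ultimately show ?thesis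
      using S(2) by (auto simp: mem_lower_iff_mem_upper)
  qed
  have "(\<Sum>\<nu>\<in>upper \<mu>. \<Sum>\<kappa>\<in>lower \<nu>. v \<kappa>) =
      (\<Sum>\<nu>\<in>upper \<mu>. \<Sum>\<kappa> | \<kappa> \<in> S \<and> \<nu> \<in> upper \<kappa>. v \<kappa>)"
    using up by (intro sum.cong) auto
  also have "\<dots> = (\<Sum>\<kappa>\<in>S. \<Sum>\<nu> | \<nu> \<in> upper \<mu> \<and> \<nu> \<in> upper \<kappa>. v \<kappa>)"
    by (rule sum.swap_restrict[OF finite_upper S(1)])
  also have "\<dots> = (\<Sum>\<kappa>\<in>S. card (upper \<mu> \<inter> upper \<kappa>) * v \<kappa>)"
    by (simp add: Int_def)
  also have "\<dots> = (\<Sum>\<kappa>\<in>S. card (lower \<mu> \<inter> lower \<kappa>) * v \<kappa> + (if \<mu> = \<kappa> then v \<kappa> else 0))"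
    using S(2) by (intro sum.cong) (auto simp: card_common_neighbours[OF \<mu>] algebra_simps)
  also have "\<dots> = (\<Sum>\<kappa>\<in>S. card (lower \<mu> \<inter> lower \<kappa>) * v \<kappa>) + v \<mu>"
    using S(1) \<open>\<mu> \<in> S\<close> by (simp add: sum.distrib)
  also have "(\<Sum>\<kappa>\<in>S. card (lower \<mu> \<inter> lower \<kappa>) * v \<kappa>) =
      (\<Sum>\<kappa>\<in>S. \<Sum>\<nu> | \<nu> \<in> lower \<mu> \<and> \<nu> \<in> lower \<kappa>. v \<kappa>)"
    by (simp add: Int_def)
  also have "\<dots> = (\<Sum>\<nu>\<in>lower \<mu>. \<Sum>\<kappa> | \<kappa> \<in> S \<and> \<nu> \<in> lower \<kappa>. v \<kappa>)"
    by (rule sum.swap_restrict[OF finite_lower S(1), symmetric])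
  also have "\<dots> = (\<Sum>\<nu>\<in>lower \<mu>. \<Sum>\<kappa>\<in>upper \<nu>. v \<kappa>)"
    using low by (intro sum.cong) auto
  finally show ?thesis .
qed

text \<open>Adjointness of \<open>U\<close> and \<open>D\<close>. The partitions of size at most \<open>N\<close> are closed under
  \<open>lower\<close> but not under \<open>upper\<close>; the sum over \<open>upper \<nu>\<close> can be cut down to them because \<open>a\<close>
  vanishes outside.\<close>

lemma sum_times_sum_lower:
  fixes a b :: "nat list \<Rightarrow> nat"
  assumes a: "\<And>\<mu>. int_partition \<mu> \<Longrightarrow> N < psize \<mu> \<Longrightarrow> a \<mu> = 0"
  shows "(\<Sum>\<mu>\<in>partitions_upto N. a \<mu> * (\<Sum>\<nu>\<in>lower \<mu>. b \<nu>)) =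
    (\<Sum>\<nu>\<in>partitions_upto N. (\<Sum>\<mu>\<in>upper \<nu>. a \<mu>) * b \<nu>)"
proof -
  let ?S = "partitions_upto N"
  have S: "int_partition \<mu>" "psize \<mu> \<le> N" if "\<mu> \<in> ?S" for \<mu>
    using that by (auto simp: partitions_upto_def)
  have low: "lower \<mu> = {\<nu>. \<nu> \<in> ?S \<and> \<mu> \<in> upper \<nu>}" if "\<mu> \<in> ?S" for \<mu>
  proof -
    have "lower \<mu> \<subseteq> ?S"
      using lower_subset[of \<mu>] S(2)[OF that] by (fastforce simp: partitions_upto_def)
    then show ?thesis
      using S(1) that by (auto simp: mem_lower_iff_mem_upper)
  qed
  have "(\<Sum>\<mu>\<in>?S. a \<mu> * (\<Sum>\<nu>\<in>lower \<mu>. b \<nu>)) =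
      (\<Sum>\<mu>\<in>?S. \<Sum>\<nu> | \<nu> \<in> ?S \<and> \<mu> \<in> upper \<nu>. a \<mu> * b \<nu>)"
    using low by (intro sum.cong) (auto simp: sum_distrib_left)
  also have "\<dots> = (\<Sum>\<nu>\<in>?S. \<Sum>\<mu> | \<mu> \<in> ?S \<and> \<mu> \<in> upper \<nu>. a \<mu> * b \<nu>)"
    by (rule sum.swap_restrict[OF finite_partitions_upto finite_partitions_upto])
  also have "\<dots> = (\<Sum>\<nu>\<in>?S. (\<Sum>\<mu>\<in>upper \<nu>. a \<mu>) * b \<nu>)"
  proof (rule sum.cong[OF refl])
    fix \<nu>
    have "(\<Sum>\<mu> | \<mu> \<in> ?S \<and> \<mu> \<in> upper \<nu>. a \<mu> * b \<nu>) = (\<Sum>\<mu>\<in>upper \<nu>. a \<mu> * b \<nu>)"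
    proof (rule sum.mono_neutral_left)
      show "\<forall>\<mu>\<in>upper \<nu> - {\<mu>. \<mu> \<in> ?S \<and> \<mu> \<in> upper \<nu>}. a \<mu> * b \<nu> = 0"
      proof
        fix \<mu> assume "\<mu> \<in> upper \<nu> - {\<mu>. \<mu> \<in> ?S \<and> \<mu> \<in> upper \<nu>}"
        then have "a \<mu> = 0"
          by (intro a) (auto simp: partitions_upto_def mem_upper_iff)
        then show "a \<mu> * b \<nu> = 0" by simp
      qed
    qed (auto simp: finite_upper)
    then show "(\<Sum>\<mu> | \<mu> \<in> ?S \<and> \<mu> \<in> upper \<nu>. a \<mu> * b \<nu>) = (\<Sum>\<mu>\<in>upper \<nu>. a \<mu>) * b \<nu>"
      by (simp add: sum_distrib_right)
  qed
  finally show ?thesis .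
qed

section \<open>Counting tableaux\<close>

text \<open>A single condition per step, whose direction depends on the parity of the position, is what
  permits the removal of the last partition.\<close>

lemma tableau_iff_steps:
  "simplified_vacillating_tableau n \<mu> T \<longleftrightarrow>
     length T = n + 1 \<and> (\<forall>\<nu> \<in> set T. int_partition \<nu>) \<and> T ! 0 = [] \<and> T ! n = \<mu> \<and>
     (\<forall>i<n. if even i then T ! Suc i \<in> lower (T ! i) else T ! i \<in> lower (T ! Suc i))"
proof -
  have steps: "((\<forall>j. 2 * j + 1 \<le> n \<longrightarrow>
        contained (T ! (2 * j + 1)) (T ! (2 * j)) \<and>
        skew_size (T ! (2 * j)) (T ! (2 * j + 1)) \<in> {0, 1}) \<and>
     (\<forall>j. 2 * j + 2 \<le> n \<longrightarrow>
        contained (T ! (2 * j + 1)) (T ! (2 * j + 2)) \<and>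
        skew_size (T ! (2 * j + 2)) (T ! (2 * j + 1)) \<in> {0, 1})) \<longleftrightarrow>
     (\<forall>i<n. if even i then T ! Suc i \<in> lower (T ! i) else T ! i \<in> lower (T ! Suc i))"
    (is "?A \<longleftrightarrow> ?B")
    if "length T = n + 1" and part: "\<forall>\<nu> \<in> set T. int_partition \<nu>"
  proof
    have p: "int_partition (T ! i)" if "i \<le> n" for i
      using \<open>length T = n + 1\<close> part that by auto
    show "?B" if "?A"
    proof (intro allI impI)
      fix i assume i: "i < n"
      show "if even i then T ! Suc i \<in> lower (T ! i) else T ! i \<in> lower (T ! Suc i)"
      proof (cases "even i")
        case True
        then obtain j where "i = 2 * j" by (elim evenE)
        then show ?thesis
          using \<open>?A\<close> i p[of i] p[of "Suc i"] by (auto simp: lower_def)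
      next
        case False
        then obtain j where "i = 2 * j + 1" by (elim oddE)
        then show ?thesis
          using \<open>?A\<close> i p[of i] p[of "Suc i"] by (auto simp: lower_def)
      qed
    qed
    show "?A" if B: "?B"
    proof (intro conjI allI impI)
      fix j assume "2 * j + 1 \<le> n"
      then have "T ! (2 * j + 1) \<in> lower (T ! (2 * j))"
        using B[rule_format, of "2 * j"] by simp
      then show "contained (T ! (2 * j + 1)) (T ! (2 * j))"
        "skew_size (T ! (2 * j)) (T ! (2 * j + 1)) \<in> {0, 1}"
        unfolding lower_def by blast+
    next
      fix j assume "2 * j + 2 \<le> n"
      then have "T ! (2 * j + 1) \<in> lower (T ! (2 * j + 2))"
        using B[rule_format, of "2 * j + 1"] by simp
      then show "contained (T ! (2 * j + 1)) (T ! (2 * j + 2))"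
        "skew_size (T ! (2 * j + 2)) (T ! (2 * j + 1)) \<in> {0, 1}"
        unfolding lower_def by blast+
    qed
  qed
  show ?thesis
    unfolding simplified_vacillating_tableau_def by (intro conj_cong refl steps; assumption)
qed

lemma tableaux_Suc:
  assumes \<mu>: "int_partition \<mu>"
  shows "{T. simplified_vacillating_tableau (Suc n) \<mu> T} =
    (\<Union>\<nu>\<in>(if even n then upper \<mu> else lower \<mu>).
       (\<lambda>T. T @ [\<mu>]) ` {T. simplified_vacillating_tableau n \<nu> T})"
  (is "?L = (\<Union>\<nu>\<in>?N. ?f ` ?T \<nu>)")
proof (intro equalityI subsetI)
  fix T assume "T \<in> ?L"
  then have T: "length T = n + 2" "\<forall>\<nu> \<in> set T. int_partition \<nu>" "T ! 0 = []" "T ! Suc n = \<mu>"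
    and step: "\<And>i. i < Suc n \<Longrightarrow>
      if even i then T ! Suc i \<in> lower (T ! i) else T ! i \<in> lower (T ! Suc i)"
    by (auto simp: tableau_iff_steps)
  define T' where "T' = butlast T"
  have T': "T = T' @ [\<mu>]"
    using T(1,4) last_conv_nth[of T] append_butlast_last_id[of T] by (force simp: T'_def)
  then have len: "length T' = n + 1" using T(1) by simp
  have nth: "T' ! i = T ! i" if "i \<le> n" for i
    using that len by (simp add: T' nth_append)
  have "int_partition (T ! n)"
    using T(1,2) by simp
  then have "T' ! n \<in> ?N"
    using step[of n] T(4) nth[of n] \<mu> by (auto simp: mem_lower_iff_mem_upper)
  moreover have "T' \<in> ?T (T' ! n)"
    unfolding mem_Collect_eq tableau_iff_steps
  proof (intro conjI allI impI)
    show "\<forall>\<nu>\<in>set T'. int_partition \<nu>" "T' ! 0 = []"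
      using T(2,3) nth[of 0] by (simp_all add: T')
    fix i assume "i < n"
    then show "if even i then T' ! Suc i \<in> lower (T' ! i) else T' ! i \<in> lower (T' ! Suc i)"
      using step[of i] nth[of i] nth[of "Suc i"] by simp
  qed (simp_all add: len)
  ultimately show "T \<in> (\<Union>\<nu>\<in>?N. ?f ` ?T \<nu>)"
    using T' by blast
next
  fix T assume "T \<in> (\<Union>\<nu>\<in>?N. ?f ` ?T \<nu>)"
  then obtain \<nu> T' where \<nu>: "\<nu> \<in> ?N" and T: "T = T' @ [\<mu>]"
    and T': "simplified_vacillating_tableau n \<nu> T'"
    by blast
  have "int_partition \<nu>"
    using \<nu> by (auto simp: mem_upper_iff mem_lower_iff split: if_splits)
  with \<nu> have last: "if even n then \<mu> \<in> lower \<nu> else \<nu> \<in> lower \<mu>"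
    using \<mu> by (auto simp: mem_lower_iff_mem_upper)
  show "T \<in> ?L"
    using T' \<mu> last unfolding mem_Collect_eq tableau_iff_steps
    by (auto simp: T nth_append less_Suc_eq)
qed

lemma tableaux_0:
  "{T. simplified_vacillating_tableau 0 \<mu> T} = (if \<mu> = [] then {[[]]} else {})"
proof -
  have "simplified_vacillating_tableau 0 \<mu> T \<longleftrightarrow> T = [[]] \<and> \<mu> = []" for T
    unfolding tableau_iff_steps by (cases T) (auto simp: int_partition_def)
  then show ?thesis by auto
qed

lemma tableau_last: "simplified_vacillating_tableau n \<mu> T \<Longrightarrow> T ! n = \<mu>"
  unfolding simplified_vacillating_tableau_def by blast

lemma tableaux_not_partition:
  assumes "\<not> int_partition \<mu>"
  shows "{T. simplified_vacillating_tableau n \<mu> T} = {}"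
proof -
  have "int_partition (T ! n)" if "simplified_vacillating_tableau n \<mu> T" for T
    using that nth_mem[of n T] unfolding simplified_vacillating_tableau_def by simp
  then show ?thesis
    using assms tableau_last by blast
qed

lemma finite_tableaux: "finite {T. simplified_vacillating_tableau n \<mu> T}"
proof (induction n arbitrary: \<mu>)
  case 0
  then show ?case by (simp add: tableaux_0)
next
  case (Suc n)
  show ?case
  proof (cases "int_partition \<mu>")
    case True
    then show ?thesis
      unfolding tableaux_Suc[OF True]
      by (intro finite_UN_I finite_imageI Suc.IH) (simp add: finite_upper finite_lower)
  qed (simp add: tableaux_not_partition)
qed

lemma card_tableaux_Suc:
  assumes "int_partition \<mu>"
  shows "card {T. simplified_vacillating_tableau (Suc n) \<mu> T} =
    (\<Sum>\<nu>\<in>(if even n then upper \<mu> else lower \<mu>). card {T. simplified_vacillating_tableau n \<nu> T})"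
  unfolding tableaux_Suc[OF assms]
proof (subst card_UN_disjoint)
  show "finite (if even n then upper \<mu> else lower \<mu>)"
    by (simp add: finite_upper finite_lower)
qed (auto simp: finite_tableaux card_image inj_on_def dest: tableau_last)

lemma g_0: "g 0 \<mu> = (if \<mu> = [] then 1 else 0)"
  by (simp add: g_def tableaux_0)

lemma g_half_eq_sum_upper: "int_partition \<mu> \<Longrightarrow> g_half k \<mu> = (\<Sum>\<nu>\<in>upper \<mu>. g k \<nu>)"
  using card_tableaux_Suc[of \<mu> "2 * k"] by (simp add: g_def g_half_def)

lemma g_Suc_eq_sum_lower: "int_partition \<mu> \<Longrightarrow> g (Suc k) \<mu> = (\<Sum>\<nu>\<in>lower \<mu>. g_half k \<nu>)"
  using card_tableaux_Suc[of \<mu> "2 * k + 1"] by (simp add: g_def g_half_def)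

lemma int_partition_Nil: "int_partition []"
  by (simp add: int_partition_def)

lemma young_diagram_Nil: "young_diagram [] = {}"
  by (simp add: young_diagram_def)

lemma lower_Nil: "lower [] = {[]}"
proof -
  have "\<nu> = []" if "\<nu> \<in> lower []" for \<nu>
    using that by (intro young_diagram_inj) (auto simp: mem_lower_iff int_partition_Nil young_diagram_Nil)
  moreover have "[] \<in> lower []"
    by (simp add: mem_lower_iff int_partition_Nil)
  ultimately show ?thesis by blast
qed

lemma Nil_mem_upper_iff:
  assumes "int_partition \<mu>"
  shows "[] \<in> upper \<mu> \<longleftrightarrow> \<mu> = []"
  using assms mem_lower_iff_mem_upper[OF int_partition_Nil assms] by (simp add: lower_Nil)

lemma binomial_sum_Suc:
  fixes f :: "nat \<Rightarrow> nat"
  shows "(\<Sum>i\<le>k. (k choose i) * f (Suc i)) + (\<Sum>i\<le>k. (k choose i) * f i) =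
    (\<Sum>i\<le>Suc k. (Suc k choose i) * f i)"
proof -
  have "(\<Sum>i\<le>k. (k choose i) * f i) = (\<Sum>i\<le>Suc k. (k choose i) * f i)"
    by (simp add: binomial_eq_0)
  also have "\<dots> = f 0 + (\<Sum>i\<le>k. (k choose Suc i) * f (Suc i))"
    by (subst sum.atMost_Suc_shift) simp
  finally show ?thesis
    by (subst sum.atMost_Suc_shift) (simp add: sum.distrib algebra_simps)
qed

text \<open>The induction on \<open>k\<close> is \<open>D (U D)\<^sup>k\<^sup>+\<^sup>1 = U D (D (U D)\<^sup>k) + D (U D)\<^sup>k\<close>, applied to \<open>g 0\<close>;
  with the induction hypothesis, the two summands combine by Pascal's rule. The base case says that
  \<open>D\<close> fixes the indicator of the empty partition.\<close>

lemma g_half_eq_binomial_sum: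
  "int_partition \<mu> \<Longrightarrow> g_half k \<mu> = (\<Sum>i\<le>k. (k choose i) * g i \<mu>)"
proof (induction k arbitrary: \<mu>)
  case 0
  have "(\<Sum>\<nu>\<in>upper \<mu>. g 0 \<nu>) = (if [] \<in> upper \<mu> then 1 else 0)"
    by (simp add: g_0 finite_upper)
  then show ?case
    using 0 by (simp add: g_half_eq_sum_upper Nil_mem_upper_iff g_0)
next
  case (Suc k)
  have part: "int_partition \<nu>" if "\<nu> \<in> upper \<kappa> \<or> \<nu> \<in> lower \<kappa>" for \<nu> \<kappa>
    using that by (auto simp: mem_upper_iff mem_lower_iff)
  have inner: "(\<Sum>\<kappa>\<in>upper \<nu>. g_half k \<kappa>) = (\<Sum>i\<le>k. (k choose i) * g_half i \<nu>)"
    if "int_partition \<nu>" for \<nu>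
  proof -
    have "(\<Sum>\<kappa>\<in>upper \<nu>. g_half k \<kappa>) = (\<Sum>\<kappa>\<in>upper \<nu>. \<Sum>i\<le>k. (k choose i) * g i \<kappa>)"
      using Suc.IH part by (intro sum.cong) blast+
    also have "\<dots> = (\<Sum>i\<le>k. (k choose i) * g_half i \<nu>)"
      using that by (subst sum.swap) (simp add: g_half_eq_sum_upper sum_distrib_left)
    finally show ?thesis .
  qed
  have "g_half (Suc k) \<mu> = (\<Sum>\<nu>\<in>upper \<mu>. \<Sum>\<kappa>\<in>lower \<nu>. g_half k \<kappa>)"
    unfolding g_half_eq_sum_upper[OF Suc.prems]
    by (intro sum.cong refl g_Suc_eq_sum_lower) (simp add: mem_upper_iff)
  also have "\<dots> = (\<Sum>\<nu>\<in>lower \<mu>. \<Sum>\<kappa>\<in>upper \<nu>. g_half k \<kappa>) + g_half k \<mu>"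
    by (rule sum_neighbours_commute[OF Suc.prems])
  also have "(\<Sum>\<nu>\<in>lower \<mu>. \<Sum>\<kappa>\<in>upper \<nu>. g_half k \<kappa>) =
      (\<Sum>\<nu>\<in>lower \<mu>. \<Sum>i\<le>k. (k choose i) * g_half i \<nu>)"
    using inner part by (intro sum.cong) blast+
  also have "\<dots> = (\<Sum>i\<le>k. (k choose i) * g (Suc i) \<mu>)"
    using Suc.prems by (subst sum.swap) (simp add: g_Suc_eq_sum_lower sum_distrib_left)
  finally show ?case
    using Suc.IH[OF Suc.prems] binomial_sum_Suc[of k "\<lambda>i. g i \<mu>"] by simp
qed

text \<open>Every two steps of a tableau add at most one box. This makes the sum over all partitions finite.\<close>

lemma g_eq_0:
  "int_partition \<mu> \<Longrightarrow> k < psize \<mu> \<Longrightarrow> g k \<mu> = 0"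
proof (induction k arbitrary: \<mu>)
  case 0
  then show ?case by (auto simp: g_0 young_diagram_Nil)
next
  case (Suc k)
  have "g_half k \<nu> = 0" if "\<nu> \<in> lower \<mu>" for \<nu>
  proof -
    have \<nu>: "int_partition \<nu>" "k < psize \<nu>"
      using that Suc.prems by (auto simp: mem_lower_iff)
    have "g k \<kappa> = 0" if "\<kappa> \<in> upper \<nu>" for \<kappa>
    proof (rule Suc.IH)
      show "int_partition \<kappa>" using that by (simp add: mem_upper_iff)
      have "psize \<nu> \<le> psize \<kappa>"
        using that by (simp add: mem_upper_iff card_mono finite_young_diagram)
      then show "k < psize \<kappa>" using \<nu> by simp
    qed
    then show ?thesis using \<nu> by (simp add: g_half_eq_sum_upper)
  qed
  then show ?case using Suc.prems by (simp add: g_Suc_eq_sum_lower)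
qed

text \<open>Self-adjointness of \<open>U D\<close> moves its powers from one factor to the other. By adjointness,
  both \<open>\<Sum>\<mu>. g i \<mu> * g (Suc j) \<mu>\<close> and \<open>\<Sum>\<mu>. g (Suc i) \<mu> * g j \<mu>\<close> equal
  \<open>\<Sum>\<mu>. g_half i \<mu> * g_half j \<mu>\<close>.\<close>

lemma sum_g_mult_g:
  "i + j \<le> N \<Longrightarrow> (\<Sum>\<mu>\<in>partitions_upto N. g i \<mu> * g j \<mu>) = g (i + j) []"
proof (induction j arbitrary: i)
  case 0
  have "[] \<in> partitions_upto N"
    by (simp add: partitions_upto_def int_partition_Nil young_diagram_Nil)
  then have "(\<Sum>\<mu>\<in>partitions_upto N. g i \<mu> * (if \<mu> = [] then 1 else 0)) = g i []"
    by (simp add: finite_partitions_upto if_distrib cong: if_cong)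
  then show ?case by (simp add: g_0)
next
  case (Suc j)
  let ?S = "partitions_upto N"
  have part: "int_partition \<mu>" if "\<mu> \<in> ?S" for \<mu>
    using that by (simp add: partitions_upto_def)
  have shift: "(\<Sum>\<mu>\<in>?S. g a \<mu> * g (Suc b) \<mu>) = (\<Sum>\<nu>\<in>?S. g_half a \<nu> * g_half b \<nu>)"
    if "a \<le> N" for a b
  proof -
    have "(\<Sum>\<mu>\<in>?S. g a \<mu> * g (Suc b) \<mu>) = (\<Sum>\<mu>\<in>?S. g a \<mu> * (\<Sum>\<nu>\<in>lower \<mu>. g_half b \<nu>))"
      by (simp add: part g_Suc_eq_sum_lower)
    also have "\<dots> = (\<Sum>\<nu>\<in>?S. (\<Sum>\<mu>\<in>upper \<nu>. g a \<mu>) * g_half b \<nu>)"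
      using that g_eq_0 by (intro sum_times_sum_lower) auto
    finally show ?thesis
      by (simp add: part g_half_eq_sum_upper)
  qed
  have "(\<Sum>\<mu>\<in>?S. g i \<mu> * g (Suc j) \<mu>) = (\<Sum>\<mu>\<in>?S. g j \<mu> * g (Suc i) \<mu>)"
    using shift[of i j] shift[of j i] Suc.prems by (simp add: mult.commute)
  then show ?case
    using Suc.IH[of "Suc i"] Suc.prems by (simp add: mult.commute)
qed

text \<open>The Bell recursion, which holds because \<open>[]\<close> is the only lower neighbour of \<open>[]\<close>.\<close>

lemma g_Suc_Nil: "g (Suc n) [] = (\<Sum>i\<le>n. (n choose i) * g i [])"
  by (simp add: g_Suc_eq_sum_lower lower_Nil int_partition_Nil g_half_eq_binomial_sum)

section \<open>Set partitions with a constrained block\<close>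

text \<open>Deleting the block of \<open>a\<close> leaves an arbitrary partition of the remaining elements. The sum is
  indexed by the set \<open>T\<close> of elements of \<open>L\<close> outside that block; the block is recovered from \<open>T\<close> as
  \<open>insert a (L - T)\<close>.\<close>

lemma card_partitions_block_subset:
  assumes fin: "finite A" and a: "a \<in> A" and L: "L \<subseteq> A - {a}"
  shows "card {P. partition_on A P \<and> (\<exists>B\<in>P. a \<in> B \<and> B \<subseteq> insert a L)} =
    (\<Sum>T\<in>Pow L. card {Q. partition_on (T \<union> (A - insert a L)) Q})"
proof -
  define block where "block T = insert a (L - T)" for T
  define rest where "rest T = T \<union> (A - insert a L)" for T
  have rest: "A - block T = rest T" "a \<notin> rest T" "block T \<subseteq> A" if "T \<in> Pow L" for T
    using that a L by (auto simp: block_def rest_def)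
  have finL: "finite L" using fin L by (meson finite_Diff finite_subset)
  have notin: "a \<notin> B" if "partition_on (rest T) Q" "T \<in> Pow L" "B \<in> Q" for T Q B
    using rest(2) that by (auto simp: partition_on_def)
  have insert: "partition_on A (insert (block T) Q) \<longleftrightarrow> partition_on (rest T) Q"
    if "T \<in> Pow L" "disjnt (block T) (\<Union>Q)" for T Q
    using partition_on_insert[OF that(2), of A] rest[OF that(1)] by (auto simp: block_def)
  have disj: "disjnt (block T) (\<Union>Q)" if "T \<in> Pow L" "partition_on (rest T) Q" for T Q
    using that rest(1)[OF that(1)] by (auto simp: partition_on_def disjnt_def)
  have "{P. partition_on A P \<and> (\<exists>B\<in>P. a \<in> B \<and> B \<subseteq> insert a L)} =
      (\<Union>T\<in>Pow L. insert (block T) ` {Q. partition_on (rest T) Q})"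
  proof (intro equalityI subsetI)
    fix P assume "P \<in> {P. partition_on A P \<and> (\<exists>B\<in>P. a \<in> B \<and> B \<subseteq> insert a L)}"
    then obtain B where P: "partition_on A P" and B: "B \<in> P" "a \<in> B" "B \<subseteq> insert a L"
      by blast
    define T where "T = L - B"
    have T: "T \<in> Pow L" and "block T = B"
      using B L by (auto simp: T_def block_def)
    have "disjnt B (\<Union>(P - {B}))"
      using P B(1) by (auto simp: partition_on_def disjoint_def disjnt_def)
    moreover have "P = insert B (P - {B})"
      using B by blast
    ultimately have "partition_on (rest T) (P - {B})" "P = insert (block T) (P - {B})"
      using P insert[OF T, of "P - {B}"] \<open>block T = B\<close> by simp_all
    then show "P \<in> (\<Union>T\<in>Pow L. insert (block T) ` {Q. partition_on (rest T) Q})"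
      using T by blast
  next
    fix P assume "P \<in> (\<Union>T\<in>Pow L. insert (block T) ` {Q. partition_on (rest T) Q})"
    then obtain T Q where T: "T \<in> Pow L" and Q: "partition_on (rest T) Q"
      and P: "P = insert (block T) Q"
      by blast
    have "partition_on A P"
      using insert[OF T disj[OF T Q]] Q P by simp
    then show "P \<in> {P. partition_on A P \<and> (\<exists>B\<in>P. a \<in> B \<and> B \<subseteq> insert a L)}"
      by (auto simp: P block_def)
  qed
  also have "card \<dots> = (\<Sum>T\<in>Pow L. card (insert (block T) ` {Q. partition_on (rest T) Q}))"
  proof (rule card_UN_disjoint)
    show "finite (Pow L)" using finL by simp
    have "finite (rest T)" if "T \<in> Pow L" for T
      using that fin finL by (auto simp: rest_def intro: finite_subset)
    then show "\<forall>T\<in>Pow L. finite (insert (block T) ` {Q. partition_on (rest T) Q})"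
      by (simp add: finitely_many_partition_on)
    have unique: "T = T'"
      if "T \<in> Pow L" "T' \<in> Pow L" "partition_on (rest T) Q" "partition_on (rest T') Q'"
        and eq: "insert (block T) Q = insert (block T') Q'" for T T' Q Q'
    proof -
      have "block T \<notin> Q'"
        using notin[OF that(4,2), of "block T"] by (auto simp: block_def)
      then have "block T = block T'"
        using eq by blast
      then show "T = T'"
        using that(1,2) L by (auto simp: block_def)
    qed
    show "\<forall>T\<in>Pow L. \<forall>T'\<in>Pow L. T \<noteq> T' \<longrightarrow>
        insert (block T) ` {Q. partition_on (rest T) Q} \<inter>
        insert (block T') ` {Q. partition_on (rest T') Q} = {}"
    proof (intro ballI impI equals0I)
      fix T T' P
      assume T: "T \<in> Pow L" "T' \<in> Pow L" "T \<noteq> T'"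
        and "P \<in> insert (block T) ` {Q. partition_on (rest T) Q} \<inter>
          insert (block T') ` {Q. partition_on (rest T') Q}"
      then obtain Q Q' where "partition_on (rest T) Q" "P = insert (block T) Q"
        "partition_on (rest T') Q'" "P = insert (block T') Q'"
        by (elim IntE imageE CollectE)
      then show False
        using unique[of T T' Q Q'] T by simp
    qed
  qed
  also have "\<dots> = (\<Sum>T\<in>Pow L. card {Q. partition_on (rest T) Q})"
  proof (rule sum.cong[OF refl], rule card_image, rule inj_onI)
    fix T Q Q'
    assume T: "T \<in> Pow L" and Q: "Q \<in> {Q. partition_on (rest T) Q}" "Q' \<in> {Q. partition_on (rest T) Q}"
      and eq: "insert (block T) Q = insert (block T) Q'"
    have "block T \<notin> Q" "block T \<notin> Q'"
      using notin[OF _ T, of _ "block T"] Q by (auto simp: block_def)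
    then show "Q = Q'" using eq insert_ident by metis
  qed
  finally show ?thesis by (simp add: rest_def)
qed

lemma sum_Pow_card:
  fixes f :: "nat \<Rightarrow> nat"
  assumes fin: "finite L"
  shows "(\<Sum>T\<in>Pow L. f (card T)) = (\<Sum>i\<le>card L. (card L choose i) * f i)"
proof -
  have "(\<Sum>T\<in>Pow L. f (card T)) = (\<Sum>i\<le>card L. \<Sum>T | T \<in> Pow L \<and> card T = i. f (card T))"
    by (rule sum.group[symmetric]) (use fin in \<open>auto intro: card_mono\<close>)
  also have "\<dots> = (\<Sum>i\<le>card L. (card L choose i) * f i)"
    using n_subsets[OF fin] by (intro sum.cong) auto
  finally show ?thesis .
qed

text \<open>Both sides satisfy the Bell recursion. On the left it is the case of
  \<open>card_partitions_block_subset\<close> without a constraint, \<open>L = A - {a}\<close>.\<close>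

lemma card_partition_on_eq_g:
  assumes "finite A"
  shows "card {P. partition_on A P} = g (card A) []"
  using assms
proof (induction "card A" arbitrary: A rule: less_induct)
  case less
  show ?case
  proof (cases "A = {}")
    case True
    then have "{P. partition_on A P} = {{}}"
      by (simp add: partition_on_empty)
    then show ?thesis using True by (simp add: g_0)
  next
    case False
    then obtain a where a: "a \<in> A" by blast
    define L where "L = A - {a}"
    have L: "finite L" "card A = Suc (card L)" "A = insert a L"
      using a less.prems card_Suc_Diff1[OF less.prems a] by (auto simp: L_def)
    have "\<exists>B\<in>P. a \<in> B \<and> B \<subseteq> insert a L" if "partition_on A P" for P
      using partition_onD1[OF that] a unfolding L(3)[symmetric] by blast
    then have "{P. partition_on A P} =
        {P. partition_on A P \<and> (\<exists>B\<in>P. a \<in> B \<and> B \<subseteq> insert a L)}"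
      by (intro Collect_cong) blast
    also have "card \<dots> = (\<Sum>T\<in>Pow L. card {Q. partition_on (T \<union> (A - insert a L)) Q})"
      using a less.prems by (intro card_partitions_block_subset) (auto simp: L_def)
    also have "\<dots> = (\<Sum>T\<in>Pow L. g (card T) [])"
    proof (rule sum.cong[OF refl])
      fix T assume "T \<in> Pow L"
      then have "card T < card A" "finite T"
        using L(1,2) card_mono[of L T] finite_subset[of T L] by auto
      then have "card {Q. partition_on T Q} = g (card T) []"
        by (rule less.hyps)
      then show "card {Q. partition_on (T \<union> (A - insert a L)) Q} = g (card T) []"
        using L(3) by simp
    qed
    also have "\<dots> = g (card A) []"
      using sum_Pow_card[OF L(1), of "\<lambda>i. g i []"] by (simp add: L(2) g_Suc_Nil)
    finally show ?thesis .
  qed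
qed

section \<open>The sum over all shapes\<close>

theorem theorem10:
  fixes k1 k2 :: nat
  shows "((\<lambda>\<mu>. g_half k1 \<mu> * g k2 \<mu>) has_sum
           card {P. partition_on {1..k1 + k2 + 1} P \<and>
                    (\<exists>B \<in> P. k1 + 1 \<in> B \<and> Max B = k1 + 1)})
         {\<mu>. int_partition \<mu>}"
proof -
  let ?A = "{1..k1 + k2 + 1}" and ?a = "k1 + 1" and ?L = "{1..k1}"
  let ?S = "partitions_upto (k1 + k2)"
  have Max: "?a \<in> B \<and> Max B = ?a \<longleftrightarrow> ?a \<in> B \<and> B \<subseteq> insert ?a ?L"
    if "partition_on ?A P" "B \<in> P" for P B
  proof -
    have "B \<subseteq> ?A" using that by (auto simp: partition_on_def)
    then have "finite B" by (rule finite_subset) simp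
    show ?thesis
    proof (intro conj_cong refl iffI)
      assume "Max B = ?a"
      then have "b \<le> ?a" if "b \<in> B" for b
        using Max_ge[OF \<open>finite B\<close> that] by simp
      then show "B \<subseteq> insert ?a ?L"
        using \<open>B \<subseteq> ?A\<close> by fastforce
    next
      assume "?a \<in> B" "B \<subseteq> insert ?a ?L"
      then show "Max B = ?a"
        using \<open>finite B\<close> by (intro Max_eqI) auto
    qed
  qed
  have "card {P. partition_on ?A P \<and> (\<exists>B \<in> P. ?a \<in> B \<and> Max B = ?a)} =
      card {P. partition_on ?A P \<and> (\<exists>B \<in> P. ?a \<in> B \<and> B \<subseteq> insert ?a ?L)}"
    using Max by (intro arg_cong[of _ _ card] Collect_cong) blast
  also have "\<dots> = (\<Sum>T\<in>Pow ?L. card {Q. partition_on (T \<union> (?A - insert ?a ?L)) Q})"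
    by (rule card_partitions_block_subset) auto
  also have "\<dots> = (\<Sum>T\<in>Pow ?L. g (card T + k2) [])"
  proof (rule sum.cong[OF refl])
    fix T assume T: "T \<in> Pow ?L"
    have R: "?A - insert ?a ?L = {k1 + 2..k1 + k2 + 1}" by auto
    have "finite T" using T finite_subset[of T ?L] by simp
    moreover have "card (T \<union> {k1 + 2..k1 + k2 + 1}) = card T + k2"
      using T \<open>finite T\<close> by (subst card_Un_disjoint) auto
    ultimately show "card {Q. partition_on (T \<union> (?A - insert ?a ?L)) Q} = g (card T + k2) []"
      unfolding R by (subst card_partition_on_eq_g) auto
  qed
  also have "\<dots> = (\<Sum>i\<le>k1. (k1 choose i) * g (i + k2) [])"
    using sum_Pow_card[of ?L "\<lambda>i. g (i + k2) []"] by simp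
  also have "\<dots> = (\<Sum>i\<le>k1. (k1 choose i) * (\<Sum>\<mu>\<in>?S. g i \<mu> * g k2 \<mu>))"
    by (simp add: sum_g_mult_g)
  also have "\<dots> = (\<Sum>\<mu>\<in>?S. \<Sum>i\<le>k1. (k1 choose i) * g i \<mu> * g k2 \<mu>)"
    by (subst sum.swap) (simp add: sum_distrib_left mult.assoc)
  also have "\<dots> = (\<Sum>\<mu>\<in>?S. g_half k1 \<mu> * g k2 \<mu>)"
    by (intro sum.cong) (auto simp: partitions_upto_def g_half_eq_binomial_sum sum_distrib_right)
  finally have card: "card {P. partition_on ?A P \<and> (\<exists>B \<in> P. ?a \<in> B \<and> Max B = ?a)} =
      (\<Sum>\<mu>\<in>?S. g_half k1 \<mu> * g k2 \<mu>)" .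
  have "((\<lambda>\<mu>. g_half k1 \<mu> * g k2 \<mu>) has_sum (\<Sum>\<mu>\<in>?S. g_half k1 \<mu> * g k2 \<mu>)) ?S"
    by (simp add: finite_partitions_upto)
  also have "?this \<longleftrightarrow> ((\<lambda>\<mu>. g_half k1 \<mu> * g k2 \<mu>) has_sum (\<Sum>\<mu>\<in>?S. g_half k1 \<mu> * g k2 \<mu>))
      {\<mu>. int_partition \<mu>}"
    by (rule has_sum_cong_neutral) (auto simp: partitions_upto_def g_eq_0)
  finally show ?thesis unfolding card .
qed

end
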